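(* Let $f=\max_{j\in[N]}f_j$ with $f_j(x)=\log\sum_{a\in\mathcal{A}_j}f_{a,j}\exp(a^\top x)$, $x\in\mathbb{R}^n$, and suppose that $f$ is coercive. Then any minimizer $x^\star$ of $f$ over $\mathbb{R}^n$ satisfies $$\|x^\star\|_\infty\le\frac{f(0)-t_{\min}(f)}{\nu(\mathcal{A})},\qquad t_{\min}(f):=\min\{\log f_{a,j}: a\in\mathcal{A}_j,\ j\in[N]\}.$$ Moreover, if $\mathcal{A}_j\subset\mathbb{Z}^n$ for all $j\in[N]$, then $$\nu(\mathcal{A})\ge\frac{1}{\prod_{i=1}^n\sqrt{\|b_i\|^2+1}},$$ where the elements of $\mathcal{A}=\{b_1,\dots,b_M\}$ are ordered by decreasing Euclidean norm, $\|b_1\|\ge\dots\ge\|b_M\|$.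
   Context: $n,N$ are positive integers, $[N]=\{1,\dots,N\}$. For each $j\in[N]$, $\mathcal{A}_j\subset\mathbb{R}^n$ is a nonempty finite set and $f_{a,j}>0$ for $a\in\mathcal{A}_j$. $\mathcal{A}=\bigcup_{j\in[N]}\mathcal{A}_j$ and $b_1,\dots,b_M$ denote its distinct elements, $M=|\mathcal{A}|$ (coercivity of $f$ forces $M\ge n+1$). The function $f$ is coercive if all its sublevel sets are compact. The coercivity constant is $$\nu(\mathcal{A})=\min_{x\in\mathbb{R}^n,\ \|x\|_\infty=1}\ \max\{a^\top x: a\in\mathcal{A}\}.$$ $\|\cdot\|$ denotes the Euclidean norm and $\|\cdot\|_\infty$ the sup norm. *)

theory Defs
  imports "HOL-Analysis.Analysis"
begin

definition lse :: "(real ^ 'n) set \<Rightarrow> (real ^ 'n \<Rightarrow> real) \<Rightarrow> real ^ 'n \<Rightarrow> real" where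
  "lse A c x = ln (\<Sum>a\<in>A. c a * exp (a \<bullet> x))"

text \<open>The data of the problem are \<open>A j\<close> and \<open>c j a\<close>, for \<open>1 \<le> j \<le> N\<close> and \<open>a \<in> A j\<close>, the
  latter standing for the coefficient \<open>f_{a,j}\<close>; values outside these ranges are irrelevant.\<close>

definition max_lse ::
  "nat \<Rightarrow> (nat \<Rightarrow> (real ^ 'n) set) \<Rightarrow> (nat \<Rightarrow> real ^ 'n \<Rightarrow> real) \<Rightarrow> real ^ 'n \<Rightarrow> real" where
  "max_lse N A c x = Max ((\<lambda>j. lse (A j) (c j) x) ` {1..N})"

definition t_min ::
  "nat \<Rightarrow> (nat \<Rightarrow> (real ^ 'n) set) \<Rightarrow> (nat \<Rightarrow> real ^ 'n \<Rightarrow> real) \<Rightarrow> real" where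
  "t_min N A c = Min {ln (c j a) | j a. j \<in> {1..N} \<and> a \<in> A j}"

definition coercive :: "('a :: topological_space \<Rightarrow> real) \<Rightarrow> bool" where
  "coercive f \<longleftrightarrow> (\<forall>r. compact {x. f x \<le> r})"

text \<open>The infimum below is a minimum whenever \<open>A\<close> is finite and nonempty, see
  \<open>coercivity_constant_attained\<close>.\<close>

definition coercivity_constant :: "(real ^ 'n) set \<Rightarrow> real" where
  "coercivity_constant A = (INF x\<in>{x. infnorm x = 1}. Max ((\<lambda>a. a \<bullet> x) ` A))"

lemma continuous_on_Max_inner:
  fixes A :: "(real ^ 'n) set"
  assumes "finite A" "A \<noteq> {}"
  shows "continuous_on S (\<lambda>x. Max ((\<lambda>a. a \<bullet> x) ` A))"
  using assms
proof (induction A rule: finite_ne_induct)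
  case (singleton a)
  show ?case by (auto intro!: continuous_intros)
next
  case (insert a F)
  have "Max ((\<lambda>a. a \<bullet> x) ` insert a F) = max (a \<bullet> x) (Max ((\<lambda>a. a \<bullet> x) ` F))" for x
    using insert by simp
  then show ?case
    using insert.IH by (simp only:) (intro continuous_intros)
qed

lemma coercivity_constant_attained:
  fixes A :: "(real ^ 'n) set"
  assumes "finite A" "A \<noteq> {}"
  shows "\<exists>x. infnorm x = 1 \<and> coercivity_constant A = Max ((\<lambda>a. a \<bullet> x) ` A) \<and>
    (\<forall>y. infnorm y = 1 \<longrightarrow> Max ((\<lambda>a. a \<bullet> x) ` A) \<le> Max ((\<lambda>a. a \<bullet> y) ` A))"
proof -
  let ?S = "{x :: real ^ 'n. infnorm x = 1}"
  let ?g = "\<lambda>x. Max ((\<lambda>a. a \<bullet> x) ` A)"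
  have "bounded ?S"
    unfolding bounded_iff
    using norm_le_infnorm[where 'a = "real ^ 'n"] by (metis (mono_tags) mem_Collect_eq mult.right_neutral)
  moreover have "closed ?S"
    by (intro closed_Collect_eq continuous_intros)
  ultimately have "compact ?S"
    by (simp add: compact_eq_bounded_closed)
  moreover have "?S \<noteq> {}"
  proof -
    define v :: "real ^ 'n" where "v = 1"
    have "infnorm v \<noteq> 0"
      by (simp add: v_def infnorm_eq_0)
    then have "infnorm ((1 / infnorm v) *\<^sub>R v) = 1"
      by (simp add: infnorm_mul infnorm_pos_le)
    then show ?thesis by blast
  qed
  ultimately obtain x where x: "x \<in> ?S" "\<forall>y\<in>?S. ?g x \<le> ?g y"
    using continuous_attains_inf[OF _ _ continuous_on_Max_inner[OF assms]] by blast
  have "(INF y\<in>?S. ?g y) = ?g x"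
    using x by (intro cInf_eq_minimum) auto
  then show ?thesis
    using x unfolding coercivity_constant_def by auto
qed

end

theory Submission
  imports Defs
begin

text \<open>Each \<open>f\<close> in the maximum dominates \<open>log f_a + a \<bullet> x\<close>, so \<open>t_min + \<nu> \<parallel>x\<parallel>\<^sub>\<infinity>\<close> is a lower bound
  for the function; compare it with the value at 0. Coercivity makes \<open>\<nu>\<close> positive. For integral
  exponents, \<open>\<nu>\<close> is a coordinate of a vertex of a polyhedron in \<open>n + 1\<close> dimensions with integral
  data, hence by Cramer's rule a quotient of integers whose denominator is a determinant with rows
  \<open>(a, -1)\<close> and unit vectors; Hadamard's inequality bounds it.\<close>

section \<open>Hadamard's inequality and integral determinants\<close>

text \<open>Gram-Schmidt, one row at a time, with \<open>I\<close> the rows treated so far. Row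
  \<open>k\<close> is replaced by its component \<open>z\<close> orthogonal to the span of all other
  rows. This subtracts an element of that span, so the determinant is kept; a projection does not
  lengthen the row; and the rows in \<open>I\<close> stay orthogonal to all others.\<close>

lemma orthogonalize_rows:
  fixes A :: "real ^ 'm ^ 'm"
  assumes "finite I"
  shows "\<exists>B :: real ^ 'm ^ 'm. det B = det A \<and> (\<forall>i. norm (B $ i) \<le> norm (A $ i)) \<and>
    (\<forall>i\<in>I. \<forall>j. j \<noteq> i \<longrightarrow> B $ i \<bullet> B $ j = 0)"
  using assms
proof (induction I rule: finite_induct)
  case empty
  show ?case by auto
next
  case (insert k I)
  then obtain B :: "real ^ 'm ^ 'm" where B: "det B = det A" "\<And>i. norm (B $ i) \<le> norm (A $ i)"
    "\<And>i j. i \<in> I \<Longrightarrow> j \<noteq> i \<Longrightarrow> B $ i \<bullet> B $ j = 0"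
    by blast
  have row: "row i B = B $ i" for i
    by (simp add: row_def)
  obtain y z where y: "y \<in> span {row j B | j. j \<noteq> k}"
    and z: "\<And>w. w \<in> span {row j B | j. j \<noteq> k} \<Longrightarrow> orthogonal z w"
    and yz: "row k B = y + z"
    by (rule orthogonal_subspace_decomp_exists[of "{row j B | j. j \<noteq> k}" "row k B"]) (rule that)
  define C :: "real ^ 'm ^ 'm" where "C = (\<chi> i. if i = k then row k B + - y else row i B)"
  have "- y \<in> span {row j B | j. j \<noteq> k}"
    using y by (rule span_neg)
  then have "det C = det B"
    unfolding C_def span_vec_eq[symmetric] by (rule det_row_span)
  have Ck: "C $ k = z"
    by (simp add: C_def yz)
  have Ci: "C $ i = B $ i" if "i \<noteq> k" for i
    using that by (simp add: C_def row)
  have orth: "z \<bullet> B $ j = 0" if "j \<noteq> k" for j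
    using z[OF span_base, of "B $ j"] that row by (auto simp: orthogonal_def)
  have "norm z \<le> norm (B $ k)"
  proof -
    have "z \<bullet> y = 0"
      using z[OF y] by (simp add: orthogonal_def)
    then have "(norm (B $ k))\<^sup>2 = (norm y)\<^sup>2 + (norm z)\<^sup>2"
      using yz row by (simp add: power2_norm_eq_inner inner_add inner_commute)
    then have "(norm z)\<^sup>2 \<le> (norm (B $ k))\<^sup>2"
      by simp
    then show ?thesis
      by (rule power2_le_imp_le) simp
  qed
  then have "norm (C $ i) \<le> norm (A $ i)" for i
    using B(2)[of i] Ci[of i] Ck by (cases "i = k") auto
  moreover have "C $ i \<bullet> C $ j = 0" if "i \<in> insert k I" "j \<noteq> i" for i j
    using that B(3)[of i j] orth[of j] orth[of i] insert.hyps Ck Ci[of i] Ci[of j]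
    by (cases "i = k"; cases "j = k") (auto simp: inner_commute)
  ultimately show ?case
    using \<open>det C = det B\<close> B(1) by metis
qed

text \<open>Once all rows are pairwise orthogonal, \<open>B ** transpose B\<close> is diagonal with
  the squared row norms as entries, and its determinant is the square of
  \<open>det B\<close>.\<close>

theorem Hadamard_inequality:
  fixes A :: "real ^ 'm ^ 'm"
  shows "\<bar>det A\<bar> \<le> (\<Prod>i\<in>UNIV. norm (A $ i))"
proof -
  obtain B :: "real ^ 'm ^ 'm" where B: "det B = det A" "\<And>i. norm (B $ i) \<le> norm (A $ i)"
    "\<And>i j. j \<noteq> i \<Longrightarrow> B $ i \<bullet> B $ j = 0"
    using orthogonalize_rows[of UNIV A] by auto
  have row: "row i B = B $ i" for i
    by (simp add: row_def)
  have "(det B)\<^sup>2 = det (B ** transpose B)"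
    by (simp add: det_mul power2_eq_square)
  also have "\<dots> = (\<Prod>i\<in>UNIV. (norm (B $ i))\<^sup>2)"
    unfolding matrix_mult_transpose_dot_row
    using B(3) by (subst det_diagonal) (simp_all add: row power2_norm_eq_inner)
  also have "\<dots> = (\<Prod>i\<in>UNIV. norm (B $ i))\<^sup>2"
    by (simp add: prod_power_distrib)
  finally have "\<bar>det B\<bar> = \<bar>\<Prod>i\<in>UNIV. norm (B $ i)\<bar>"
    by (simp add: power2_eq_iff abs_eq_iff)
  also have "\<dots> = (\<Prod>i\<in>UNIV. norm (B $ i))"
    by (simp add: prod_nonneg)
  also have "\<dots> \<le> (\<Prod>i\<in>UNIV. norm (A $ i))"
    using B(2) by (intro prod_mono) auto
  finally show ?thesis
    using B(1) by simp
qed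

lemma Ints_det:
  fixes A :: "real ^ 'm ^ 'm"
  assumes "\<And>i j. A $ i $ j \<in> \<int>"
  shows "det A \<in> \<int>"
  unfolding det_def using assms by (intro Ints_sum Ints_mult Ints_prod) auto

section \<open>Vertices of linear programs\<close>

text \<open>A linear program is given by a finite set \<open>C\<close> of pairs \<open>(p, \<beta>)\<close>, each standing for the
  constraint \<open>p \<bullet> z \<le> \<beta>\<close>.\<close>

definition feasible :: "('a::real_inner \<times> real) set \<Rightarrow> 'a \<Rightarrow> bool" where
  "feasible C z \<longleftrightarrow> (\<forall>(p, \<beta>)\<in>C. p \<bullet> z \<le> \<beta>)"

definition active :: "('a::real_inner \<times> real) set \<Rightarrow> 'a \<Rightarrow> ('a \<times> real) set" where
  "active C z = {(p, \<beta>)\<in>C. p \<bullet> z = \<beta>}"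

text \<open>The ratio test of the simplex method. Only constraints with
  \<open>p \<bullet> d > 0\<close> can block the ray from \<open>z\<close> along \<open>d\<close>;
  the step ends when the first of them becomes tight. Constraints already tight at \<open>z\<close>
  are orthogonal to \<open>d\<close> and remain tight.\<close>

lemma feasible_move_until_active:
  fixes C :: "('a::real_inner \<times> real) set"
  assumes "finite C" "feasible C z"
    and orth: "\<And>p \<beta>. (p, \<beta>) \<in> active C z \<Longrightarrow> p \<bullet> d = 0"
    and "(q, \<gamma>) \<in> C" "q \<bullet> d > 0"
  obtains e where "e > 0" "feasible C (z + e *\<^sub>R d)" "active C z \<subset> active C (z + e *\<^sub>R d)"
proof -
  define D where "D = {(p, \<beta>)\<in>C. p \<bullet> d > 0}"
  \<comment> \<open>The step length at which a constraint in \<open>D\<close> becomes tight.\<close>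
  define r where "r = (\<lambda>(p, \<beta>). (\<beta> - p \<bullet> z) / (p \<bullet> d))"
  have D: "finite D" "D \<noteq> {}"
    using assms(4,5) finite_subset[OF _ assms(1), of D] by (auto simp: D_def)
  define e where "e = Min (r ` D)"
  have "e \<in> r ` D"
    unfolding e_def using D by (intro Min_in) auto
  then obtain p' \<beta>' where p': "(p', \<beta>') \<in> C" "p' \<bullet> d > 0" "e = (\<beta>' - p' \<bullet> z) / (p' \<bullet> d)"
    by (auto simp: D_def r_def)
  \<comment> \<open>The blocking constraint is slack at \<open>z\<close>, for otherwise
    \<open>d\<close> would be orthogonal to it. Hence the step is positive.\<close>
  have "p' \<bullet> z \<noteq> \<beta>'"
    using orth[of p' \<beta>'] p' by (auto simp: active_def)
  with p'(1) assms(2) have "p' \<bullet> z < \<beta>'"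
    by (force simp: feasible_def)
  with p' have "e > 0"
    by simp
  moreover have "feasible C (z + e *\<^sub>R d)"
    unfolding feasible_def
  proof clarify
    fix p \<beta> assume p: "(p, \<beta>) \<in> C"
    then have pz: "p \<bullet> z \<le> \<beta>"
      using assms(2) by (auto simp: feasible_def)
    show "p \<bullet> (z + e *\<^sub>R d) \<le> \<beta>"
    proof (cases "p \<bullet> d > 0")
      case True
      then have "e \<le> r (p, \<beta>)"
        unfolding e_def using D p by (intro Min_le) (auto simp: D_def)
      then have "e * (p \<bullet> d) \<le> \<beta> - p \<bullet> z"
        using True by (simp add: r_def pos_le_divide_eq)
      then show ?thesis
        by (simp add: inner_add_right)
    next
      case False
      then have "e * (p \<bullet> d) \<le> 0"
        using \<open>e > 0\<close> by (simp add: mult_le_0_iff)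
      then show ?thesis
        using pz by (simp add: inner_add_right)
    qed
  qed
  moreover have "active C z \<subset> active C (z + e *\<^sub>R d)"
  proof
    show "active C z \<subseteq> active C (z + e *\<^sub>R d)"
      using orth by (auto simp: active_def inner_add_right)
    have "(p', \<beta>') \<in> active C (z + e *\<^sub>R d)"
      using p' by (simp add: active_def inner_add_right)
    moreover have "(p', \<beta>') \<notin> active C z"
      using \<open>p' \<bullet> z \<noteq> \<beta>'\<close> by (simp add: active_def)
    ultimately show "active C z \<noteq> active C (z + e *\<^sub>R d)"
      by blast
  qed
  ultimately show ?thesis
    using that by blast
qed

text \<open>Among the minimizers, one with the largest set of active constraints is a vertex: a
  direction orthogonal to the active constraints would lead to another constraint.\<close>

lemma linear_program_vertex:
  fixes C :: "('a::euclidean_space \<times> real) set"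
  assumes "finite C"
    and pointed: "\<And>d. (\<And>p \<beta>. (p, \<beta>) \<in> C \<Longrightarrow> p \<bullet> d = 0) \<Longrightarrow> d = 0"
    and "feasible C z0" and min: "\<And>z. feasible C z \<Longrightarrow> w \<bullet> z0 \<le> w \<bullet> z"
  obtains z where "feasible C z" "w \<bullet> z = w \<bullet> z0" "span (fst ` active C z) = UNIV"
proof -
  define Q where "Q = (\<lambda>z. feasible C z \<and> w \<bullet> z = w \<bullet> z0)"
  have fin: "finite (active C z)" for z
    by (rule finite_subset[OF _ assms(1)]) (auto simp: active_def)
  \<comment> \<open>The numbers of active constraints are bounded, so a largest one exists.\<close>
  have "card (active C z) < Suc (card C)" for z
    using card_mono[OF assms(1), of "active C z"] by (auto simp: active_def less_Suc_eq_le)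
  moreover have "Q z0"
    using assms(3) by (simp add: Q_def)
  ultimately obtain z where z: "Q z" "\<And>y. Q y \<Longrightarrow> card (active C y) \<le> card (active C z)"
    using ex_has_greatest_nat[of Q z0 "\<lambda>z. card (active C z)" "Suc (card C)"] by (metis less_imp_le)
  have feas: "feasible C z"
    using z(1) by (simp add: Q_def)
  have "span (fst ` active C z) = UNIV"
  proof (rule ccontr)
    assume "span (fst ` active C z) \<noteq> UNIV"
    then have "span (fst ` active C z) \<subset> span UNIV"
      by auto
    then obtain d where d: "d \<noteq> 0" "\<And>y. y \<in> span (fst ` active C z) \<Longrightarrow> orthogonal d y"
      using orthogonal_to_subspace_exists_gen by metis
    have orth: "p \<bullet> d = 0" if "(p, \<beta>) \<in> active C z" for p \<beta>
      using d(2)[OF span_base, of p] that by (force simp: orthogonal_def inner_commute)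
    obtain q \<gamma> where q: "(q, \<gamma>) \<in> C" "q \<bullet> d \<noteq> 0"
      using pointed[of d] d(1) by auto
    have no_descent: "w \<bullet> d' \<ge> 0" if d': "\<And>p \<beta>. (p, \<beta>) \<in> active C z \<Longrightarrow> p \<bullet> d' = 0" for d'
    proof (rule ccontr)
      assume neg: "\<not> w \<bullet> d' \<ge> 0"
      \<comment> \<open>A blocked ray permits the step of the ratio test; on an unblocked one every
        step is feasible, and 1 is chosen.\<close>
      obtain e where e: "e > 0" "feasible C (z + e *\<^sub>R d')"
      proof (cases "\<exists>(p, \<beta>)\<in>C. p \<bullet> d' > 0")
        case True
        then obtain p \<beta> where p: "(p, \<beta>) \<in> C" "p \<bullet> d' > 0"
          by blast
        show ?thesis
          by (rule feasible_move_until_active[OF assms(1) feas d' p]) (auto intro: that)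
      next
        case False
        then have "feasible C (z + 1 *\<^sub>R d')"
          using feas unfolding feasible_def by (fastforce simp: inner_add_right not_less)
        then show ?thesis
          using that[of 1] by simp
      qed
      have "w \<bullet> (z + e *\<^sub>R d') < w \<bullet> z0"
        using z(1) neg e(1) by (simp add: Q_def inner_add_right mult_pos_neg)
      then show False
        using min[OF e(2)] by simp
    qed
    \<comment> \<open>Neither \<open>d\<close> nor \<open>- d\<close> can lower the objective, so
      moving along them preserves optimality.\<close>
    have wd: "w \<bullet> d = 0"
      using no_descent[of d, OF orth] no_descent[of "- d"] orth by simp
    \<comment> \<open>The sign is chosen so that the constraint \<open>q\<close> blocks the
      ray.\<close>
    define d' where "d' = (if q \<bullet> d > 0 then d else - d)"
    have d': "q \<bullet> d' > 0" "w \<bullet> d' = 0" "\<And>p \<beta>. (p, \<beta>) \<in> active C z \<Longrightarrow> p \<bullet> d' = 0"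
      using q(2) wd orth by (auto simp: d'_def)
    obtain e where e: "feasible C (z + e *\<^sub>R d')" "active C z \<subset> active C (z + e *\<^sub>R d')"
      by (rule feasible_move_until_active[OF assms(1) feas d'(3) q(1) d'(1)])
    have "Q (z + e *\<^sub>R d')"
      using e(1) z(1) d'(2) by (simp add: Q_def inner_add_right)
    then show False
      using z(2) psubset_card_mono[OF fin e(2)] by (meson not_le)
  qed
  then show ?thesis
    using that[of z] z(1) unfolding Q_def by blast
qed

section \<open>Coordinates of solutions of integral systems\<close>

text \<open>Cramer's rule bounds a nonzero coordinate of the solution below by \<open>1 / \<bar>det\<bar>\<close>, since the
  numerator is a nonzero integer.\<close>

lemma integral_system_coordinate_bound:
  fixes z :: "real ^ 'm"
  assumes "independent B" "card B = CARD('m)"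
    and int: "\<And>p i. p \<in> B \<Longrightarrow> p $ i \<in> \<int>" "\<And>p. p \<in> B \<Longrightarrow> p \<bullet> z \<in> \<int>"
    and "z $ k > 0"
  shows "1 / (\<Prod>p\<in>B. norm p) \<le> z $ k"
proof -
  have "finite B"
    using assms(1) independent_bound by blast
  then obtain h :: "'m \<Rightarrow> real ^ 'm" where h: "bij_betw h UNIV B"
    using assms(2) by (metis finite finite_same_card_bij)
  then have hB: "h i \<in> B" for i
    by (auto simp: bij_betw_def)
  define X :: "real ^ 'm ^ 'm" where "X = (\<chi> i. h i)"
  have "rows X = B"
    using h by (auto simp: rows_def row_def X_def bij_betw_def)
  moreover have "span B = UNIV"
    using dim_eq_card_independent[OF assms(1)] dim_eq_full[of B] assms(2) by simp
  ultimately obtain Y :: "real ^ 'm ^ 'm" where "Y ** X = mat 1"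
    using matrix_left_invertible_span_rows[of X] by auto
  then have det: "det X \<noteq> 0"
    by (metis det_I det_mul mult_zero_right zero_neq_one)
  \<comment> \<open>Cramer's numerator: column \<open>k\<close> of \<open>X\<close> is replaced by
    the right-hand side, which is integral by assumption.\<close>
  let ?Z = "\<chi> i j. if j = k then (X *v z) $ i else X $ i $ j"
  have "det ?Z \<in> \<int>"
    using int hB by (intro Ints_det) (simp add: X_def matrix_vector_mul_component)
  moreover have zk: "det ?Z = z $ k * det X"
    by (rule cramer_lemma)
  ultimately have "1 \<le> \<bar>z $ k * det X\<bar>"
    using det assms(5) Ints_nonzero_abs_ge1[of "z $ k * det X"] by simp
  then have "1 \<le> z $ k * \<bar>det X\<bar>"
    using assms(5) by (simp add: abs_mult)
  also have "\<dots> \<le> z $ k * (\<Prod>i\<in>UNIV. norm (h i))"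
    using Hadamard_inequality[of X] assms(5) by (simp add: X_def)
  also have "(\<Prod>i\<in>UNIV. norm (h i)) = (\<Prod>p\<in>B. norm p)"
    using prod.reindex_bij_betw[OF h] .
  finally have *: "1 \<le> z $ k * (\<Prod>p\<in>B. norm p)" .
  have "(\<Prod>p\<in>B. norm p) \<ge> 0"
    by (simp add: prod_nonneg)
  then have "(\<Prod>p\<in>B. norm p) > 0"
    using * by (cases "(\<Prod>p\<in>B. norm p) = 0") auto
  with * show ?thesis
    by (simp add: pos_divide_le_eq)
qed

section \<open>The coercivity constant for integral exponents\<close>

text \<open>The type \<open>'n option\<close> has one index more than \<open>'n\<close>; the
  coordinate at \<open>None\<close> holds the epigraph variable \<open>t\<close> of the linear
  program, or its coefficient in a constraint.\<close>

definition adjoin :: "real ^ 'n \<Rightarrow> real \<Rightarrow> real ^ 'n option" where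
  "adjoin a t = (\<chi> i. case i of None \<Rightarrow> t | Some i \<Rightarrow> a $ i)"

lemma adjoin_nth [simp]: "adjoin a t $ None = t" "adjoin a t $ Some i = a $ i"
  by (simp_all add: adjoin_def)

lemma adjoin_cases:
  obtains a t where "z = adjoin a t"
proof
  show "z = adjoin (\<chi> i. z $ Some i) (z $ None)"
    by (auto simp: vec_eq_iff adjoin_def split: option.split)
qed

lemma inner_adjoin: "adjoin a t \<bullet> adjoin b s = a \<bullet> b + t * s"
proof -
  have "adjoin a t \<bullet> adjoin b s = t * s + (\<Sum>i\<in>range Some. adjoin a t $ i * adjoin b s $ i)"
    unfolding inner_vec_def UNIV_option_conv by (subst sum.insert) auto
  also have "(\<Sum>i\<in>range Some. adjoin a t $ i * adjoin b s $ i) = a \<bullet> b"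
    by (subst sum.reindex) (auto simp: inner_vec_def)
  finally show ?thesis
    by simp
qed

lemma norm_adjoin: "norm (adjoin a t) = sqrt ((norm a)\<^sup>2 + t\<^sup>2)"
  by (simp only: norm_eq_sqrt_inner[of "adjoin a t"] inner_adjoin power2_norm_eq_inner
      power2_eq_square[of t])

lemma Ints_adjoin: "(\<And>i. a $ i \<in> \<int>) \<Longrightarrow> t \<in> \<int> \<Longrightarrow> adjoin a t $ i \<in> \<int>"
  by (cases i) auto

lemma infnorm_vec_eq_1_iff:
  fixes x :: "real ^ 'n"
  shows "infnorm x = 1 \<longleftrightarrow> (\<forall>i. \<bar>x $ i\<bar> \<le> 1) \<and> (\<exists>k. \<bar>x $ k\<bar> = 1)"
proof -
  have img: "(\<lambda>i. \<bar>x \<bullet> i\<bar>) ` Basis = range (\<lambda>i. \<bar>x $ i\<bar>)"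
    by (auto simp: Basis_vec_def inner_axis image_iff)
  have "1 \<in> range (\<lambda>i. \<bar>x $ i\<bar>) \<longleftrightarrow> (\<exists>k. \<bar>x $ k\<bar> = 1)"
    by (metis (mono_tags, lifting) rangeE rangeI)
  then show ?thesis
    unfolding infnorm_Max img by (subst Max_eq_iff) auto
qed

text \<open>The minimum defining the coercivity constant, restricted to the facet \<open>x $ k = \<sigma>\<close> of the
  cube that contains a minimizer, is the linear program of minimizing \<open>t\<close> subject to
  \<open>a \<bullet> x \<le> t\<close> for \<open>a \<in> A\<close>. One of the \<open>CARD('n) + 1\<close> constraints defining a vertex can be taken
  to be that of the facet, which leaves at most \<open>CARD('n)\<close> of the form \<open>a \<bullet> x = t\<close>.\<close>

lemma coercivity_constant_lower_bound:
  fixes A :: "(real ^ 'n) set"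
  assumes A: "finite A" "A \<noteq> {}"
    and int: "\<And>a i. a \<in> A \<Longrightarrow> a $ i \<in> \<int>"
    and pos: "coercivity_constant A > 0"
  obtains S where "S \<subseteq> A" "card S \<le> CARD('n)"
    "1 / (\<Prod>a\<in>S. sqrt ((norm a)\<^sup>2 + 1)) \<le> coercivity_constant A"
proof -
  define \<nu> where "\<nu> = coercivity_constant A"
  obtain x where x: "infnorm x = 1" "\<nu> = Max ((\<lambda>a. a \<bullet> x) ` A)"
    "\<And>y. infnorm y = 1 \<Longrightarrow> \<nu> \<le> Max ((\<lambda>a. a \<bullet> y) ` A)"
    using coercivity_constant_attained[OF A] unfolding \<nu>_def by metis
  obtain k where k: "\<bar>x $ k\<bar> = 1" and le1: "\<And>i. \<bar>x $ i\<bar> \<le> 1"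
    using x(1) infnorm_vec_eq_1_iff by blast
  define \<sigma> where "\<sigma> = x $ k"
  have \<sigma>: "\<sigma> = 1 \<or> \<sigma> = -1"
    using k unfolding \<sigma>_def by linarith
  define e where "e = (\<lambda>s i. adjoin (axis i s :: real ^ 'n) 0)"
  have e_inner: "e s i \<bullet> adjoin y t = s * y $ i" for s i y t
    by (simp add: e_def inner_adjoin inner_commute[of "axis i s"] inner_axis mult.commute)
  \<comment> \<open>In the variables \<open>adjoin y t\<close>, the constraints are in turn
    \<open>a \<bullet> y \<le> t\<close>, the two sides of the cube, and
    \<open>\<sigma> * y $ k \<ge> 1\<close>, which together with the cube gives the facet.\<close>
  define C where "C = (\<lambda>a. (adjoin a (- 1), 0)) ` A \<union> range (\<lambda>i. (e 1 i, 1)) \<union>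
    range (\<lambda>i. (e (- 1) i, 1)) \<union> {(e (- \<sigma>) k, -1 :: real)}"
  have feasible: "feasible C (adjoin y t) \<longleftrightarrow>
      (\<forall>a\<in>A. a \<bullet> y \<le> t) \<and> (\<forall>i. \<bar>y $ i\<bar> \<le> 1) \<and> \<sigma> * y $ k \<ge> 1" for y t
    unfolding feasible_def C_def by (auto simp: ball_Un inner_adjoin e_inner abs_le_iff)
  have C_fin: "finite C"
    using A(1) by (simp add: C_def)
  have pointed: "d = 0" if *: "\<And>p \<beta>. (p, \<beta>) \<in> C \<Longrightarrow> p \<bullet> d = 0" for d
  proof -
    obtain y t where d: "d = adjoin y t"
      by (rule adjoin_cases)
    have "y $ i = 0" for i
      using *[of "e 1 i" 1] by (auto simp: d C_def e_inner)
    then have y: "y = 0"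
      by (simp add: vec_eq_iff)
    obtain a where "a \<in> A"
      using A(2) by blast
    then have "t = 0"
      using *[of "adjoin a (- 1)" 0] by (auto simp: d y C_def inner_adjoin)
    then show ?thesis
      by (auto simp: d y vec_eq_iff adjoin_def split: option.split)
  qed
  have "feasible C (adjoin x \<nu>)"
    unfolding feasible using A le1 \<sigma> by (auto simp: x(2) \<sigma>_def)
  \<comment> \<open>A feasible \<open>y\<close> lies on the facet, hence on the unit sphere of the
    sup norm, where the maximum over \<open>A\<close> is at least \<open>\<nu>\<close>; and
    \<open>t\<close> dominates that maximum.\<close>
  moreover have "axis None 1 \<bullet> adjoin x \<nu> \<le> axis None 1 \<bullet> z" if "feasible C z" for z
  proof -
    obtain y t where z: "z = adjoin y t"
      by (rule adjoin_cases)
    have y: "\<And>a. a \<in> A \<Longrightarrow> a \<bullet> y \<le> t" "\<And>i. \<bar>y $ i\<bar> \<le> 1" "\<sigma> * y $ k \<ge> 1"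
      using that unfolding z feasible by auto
    have "\<bar>y $ k\<bar> = 1"
      using y(2)[of k] y(3) \<sigma> by auto
    then have "infnorm y = 1"
      using y(2) infnorm_vec_eq_1_iff by blast
    then have "\<nu> \<le> Max ((\<lambda>a. a \<bullet> y) ` A)"
      by (rule x(3))
    also have "\<dots> \<le> t"
      using A y(1) by simp
    finally show ?thesis
      by (simp add: z inner_axis inner_commute[of "axis None 1"])
  qed
  ultimately obtain z where z: "feasible C z" "axis None 1 \<bullet> z = axis None 1 \<bullet> adjoin x \<nu>"
    "span (fst ` active C z) = UNIV"
    using linear_program_vertex[OF C_fin pointed] by metis
  have z_None: "z $ None = \<nu>"
    using z(2) by (simp add: inner_axis inner_commute[of "axis None 1"])
  let ?V = "fst ` active C z"
  \<comment> \<open>The cube gives the reverse inequality, so the facet constraint is tight at every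
    feasible point.\<close>
  have "(e (- \<sigma>) k, -1) \<in> active C z"
  proof -
    obtain y t where zy: "z = adjoin y t"
      by (rule adjoin_cases)
    have "\<bar>y $ k\<bar> \<le> 1" "\<sigma> * y $ k \<ge> 1"
      using z(1) unfolding zy feasible by auto
    then have "- \<sigma> * y $ k = -1"
      using \<sigma> by auto
    then show ?thesis
      by (simp add: active_def C_def zy e_inner)
  qed
  then have "{e (- \<sigma>) k} \<subseteq> ?V"
    by force
  moreover have "e (- \<sigma>) k \<noteq> 0"
  proof
    assume "e (- \<sigma>) k = 0"
    then have "e (- \<sigma>) k \<bullet> adjoin x 0 = 0"
      by simp
    then show False
      using \<sigma> by (auto simp: e_inner \<sigma>_def)
  qed
  then have "independent {e (- \<sigma>) k}"
    by simp
  \<comment> \<open>Starting from the facet normal reserves for it one of the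
    \<open>CARD('n) + 1\<close> places in a basis of active normals.\<close>
  ultimately obtain B where B: "{e (- \<sigma>) k} \<subseteq> B" "B \<subseteq> ?V" "independent B" "?V \<subseteq> span B"
    by (rule maximal_independent_subset_extend)
  have "span B = UNIV"
    using B(4) z(3) by (metis span_mono span_span top.extremum_uniqueI)
  then have card: "card B = CARD('n option)"
    using dim_eq_card_independent[OF B(3)] dim_eq_full[of B] by simp
  have B_fin: "finite B"
    using B(3) independent_bound by blast
  have VC: "\<exists>\<beta>. (p, \<beta>) \<in> C \<and> p \<bullet> z = \<beta>" if "p \<in> B" for p
    using that B(2) by (auto simp: active_def)
  have "\<sigma> \<in> \<int>"
    using \<sigma> by auto
  then have C_int: "p $ i \<in> \<int>" "\<beta> \<in> \<int>" if "(p, \<beta>) \<in> C" for p \<beta> i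
    using that int unfolding C_def e_def
    by (auto intro!: Ints_adjoin simp: axis_def)
  have "1 / (\<Prod>p\<in>B. norm p) \<le> z $ None"
  proof (rule integral_system_coordinate_bound[OF B(3) card])
    show "p $ i \<in> \<int>" "p \<bullet> z \<in> \<int>" if "p \<in> B" for p i
      using VC[OF that] C_int by blast+
    show "z $ None > 0"
      using pos by (simp add: z_None \<nu>_def)
  qed
  then have bound: "1 / (\<Prod>p\<in>B. norm p) \<le> \<nu>"
    by (simp only: z_None)
  define L where "L = (\<lambda>a :: real ^ 'n. adjoin a (- 1))"
  define S where "S = {a \<in> A. L a \<in> B}"
  have inj: "inj L"
    by (rule injI) (metis L_def adjoin_nth(2) vec_eq_iff)
  have LS: "L ` S \<subseteq> B"
    by (auto simp: S_def)
  \<comment> \<open>All rows not coming from exponents are signed unit vectors, so they contribute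
    factors 1 to Hadamard's bound.\<close>
  have unit: "norm p = 1" if "p \<in> B - L ` S" for p
  proof -
    obtain \<beta> where "(p, \<beta>) \<in> C"
      using VC[of p] \<open>p \<in> B - L ` S\<close> by blast
    moreover have "p \<noteq> L a" if "a \<in> A" for a
      using that \<open>p \<in> B - L ` S\<close> by (auto simp: S_def)
    ultimately have "p \<in> range (e 1) \<union> range (e (- 1)) \<union> {e (- \<sigma>) k}"
      unfolding C_def L_def by blast
    moreover have "norm (e s i) = \<bar>s\<bar>" for s i
      by (simp add: e_def norm_adjoin power2_norm_eq_inner inner_axis_axis)
    ultimately show ?thesis
      using \<sigma> by auto
  qed
  have "(\<Prod>p\<in>B. norm p) = (\<Prod>p\<in>L ` S. norm p)"
    using unit B_fin LS by (intro prod.mono_neutral_right) auto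
  also have "\<dots> = (\<Prod>a\<in>S. norm (L a))"
    using inj by (subst prod.reindex) (auto intro: inj_on_subset)
  also have "\<dots> = (\<Prod>a\<in>S. sqrt ((norm a)\<^sup>2 + 1))"
    by (simp add: L_def norm_adjoin)
  finally have "1 / (\<Prod>a\<in>S. sqrt ((norm a)\<^sup>2 + 1)) \<le> coercivity_constant A"
    using bound by (simp add: \<nu>_def)
  moreover have "card S \<le> CARD('n)"
  proof -
    \<comment> \<open>The facet normal has last coordinate 0, the lifted exponents have -1; so at
      least one element of \<open>B\<close> is not counted in \<open>S\<close>.\<close>
    have "e (- \<sigma>) k $ None = 0"
      by (simp add: e_def)
    then have "e (- \<sigma>) k \<notin> L ` S"
      by (auto simp: L_def)
    then have "L ` S \<subseteq> B - {e (- \<sigma>) k}"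
      using LS by blast
    then have "card (L ` S) \<le> card (B - {e (- \<sigma>) k})"
      using B_fin by (intro card_mono) auto
    then show ?thesis
      using B(1) B_fin card inj by (simp add: card_image inj_on_subset)
  qed
  ultimately show ?thesis
    using that[of S] by (auto simp: S_def)
qed

text \<open>Split off the largest index \<open>k\<close> of \<open>I\<close>. Since \<open>I\<close>
  has \<open>Suc m\<close> elements in \<open>{1..k}\<close>, \<open>Suc m \<le> k\<close> and hence
  \<open>w k \<le> w (Suc m)\<close>; induction handles the rest.\<close>

lemma prod_le_prod_initial_segment:
  fixes w :: "nat \<Rightarrow> real"
  assumes "I \<subseteq> {1..M}" "card I = m"
    and "\<And>i. w i \<ge> 0"
    and "\<And>i k. 1 \<le> i \<Longrightarrow> i \<le> k \<Longrightarrow> k \<le> M \<Longrightarrow> w k \<le> w i"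
  shows "(\<Prod>i\<in>I. w i) \<le> (\<Prod>i=1..m. w i)"
  using assms(1,2)
proof (induction m arbitrary: I)
  case 0
  then have "I = {}"
    using finite_subset by fastforce
  then show ?case by simp
next
  case (Suc m)
  have fin: "finite I"
    using Suc.prems finite_subset by blast
  define k where "k = Max I"
  have "I \<noteq> {}"
    using Suc.prems(2) by auto
  then have k: "k \<in> I" "I \<subseteq> {1..k}"
    unfolding k_def using fin Suc.prems(1) by auto
  then have "Suc m \<le> k"
    using card_mono[of "{1..k}" I] Suc.prems(2) by simp
  have "(\<Prod>i\<in>I. w i) = w k * (\<Prod>i\<in>I - {k}. w i)"
    using fin k(1) by (rule prod.remove)
  also have "\<dots> \<le> w (Suc m) * (\<Prod>i=1..m. w i)"
    using \<open>Suc m \<le> k\<close> k(1) fin Suc.prems assms(3,4) by (intro mult_mono Suc.IH prod_nonneg) auto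
  finally show ?case
    by (simp add: mult.commute)
qed

section \<open>Bounds for maxima of log-sum-exp functions\<close>

lemma lse_ge:
  assumes "finite A" "a \<in> A" "\<And>b. b \<in> A \<Longrightarrow> 0 < c b"
  shows "ln (c a) + a \<bullet> x \<le> lse A c x"
proof -
  have "c a * exp (a \<bullet> x) \<le> (\<Sum>b\<in>A. c b * exp (b \<bullet> x))"
    using assms by (intro member_le_sum) (auto intro: less_imp_le)
  then have "ln (c a * exp (a \<bullet> x)) \<le> lse A c x"
    using assms unfolding lse_def by (intro ln_mono) auto
  then show ?thesis
    using assms by (simp add: ln_mult_pos)
qed

lemma lse_mono:
  assumes "finite A" "A \<noteq> {}" "\<And>a. a \<in> A \<Longrightarrow> 0 < c a" "\<And>a. a \<in> A \<Longrightarrow> a \<bullet> x \<le> a \<bullet> y"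
  shows "lse A c x \<le> lse A c y"
proof -
  have "(\<Sum>a\<in>A. c a * exp (a \<bullet> x)) \<le> (\<Sum>a\<in>A. c a * exp (a \<bullet> y))"
    using assms by (intro sum_mono mult_left_mono) (auto intro: less_imp_le)
  moreover have "0 < (\<Sum>a\<in>A. c a * exp (a \<bullet> x))"
    using assms by (intro sum_pos) auto
  ultimately show ?thesis
    unfolding lse_def by (intro ln_mono) auto
qed

context
  fixes N :: nat and A :: "nat \<Rightarrow> (real ^ 'n) set" and c :: "nat \<Rightarrow> real ^ 'n \<Rightarrow> real"
  assumes N: "1 \<le> N"
    and fin: "\<And>j. j \<in> {1..N} \<Longrightarrow> finite (A j)"
    and ne: "\<And>j. j \<in> {1..N} \<Longrightarrow> A j \<noteq> {}"
    and c_pos: "\<And>j a. j \<in> {1..N} \<Longrightarrow> a \<in> A j \<Longrightarrow> 0 < c j a"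
begin

lemma finite_exponents: "finite (\<Union>j\<in>{1..N}. A j)"
  using fin by blast

lemma exponents_nonempty: "(\<Union>j\<in>{1..N}. A j) \<noteq> {}"
  using N ne[of 1] by fastforce

text \<open>If \<open>a \<bullet> x \<le> 0\<close> for all exponents \<open>a\<close>, then \<open>f\<close> is bounded on the ray spanned by \<open>x\<close>.\<close>

lemma coercivity_constant_pos:
  assumes "coercive (max_lse N A c)"
  shows "coercivity_constant (\<Union>j\<in>{1..N}. A j) > 0"
proof (rule ccontr)
  assume neg: "\<not> ?thesis"
  let ?A = "\<Union>j\<in>{1..N}. A j"
  obtain x where x: "infnorm x = 1" "coercivity_constant ?A = Max ((\<lambda>a. a \<bullet> x) ` ?A)"
    using coercivity_constant_attained[OF finite_exponents exponents_nonempty] by metis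
  have le0: "a \<bullet> x \<le> 0" if "a \<in> ?A" for a
  proof -
    have "a \<bullet> x \<le> Max ((\<lambda>a. a \<bullet> x) ` ?A)"
      using that finite_exponents by (intro Max_ge) auto
    then show ?thesis
      using neg x(2) by simp
  qed
  have "max_lse N A c (t *\<^sub>R x) \<le> max_lse N A c 0" if "t \<ge> 0" for t
  proof -
    have "lse (A j) (c j) (t *\<^sub>R x) \<le> max_lse N A c 0" if j: "j \<in> {1..N}" for j
    proof -
      have "lse (A j) (c j) (t *\<^sub>R x) \<le> lse (A j) (c j) 0"
      proof (rule lse_mono)
        show "a \<bullet> (t *\<^sub>R x) \<le> a \<bullet> 0" if "a \<in> A j" for a
        proof -
          have "a \<bullet> x \<le> 0"
            using that j by (intro le0) blast
          with \<open>t \<ge> 0\<close> show ?thesis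
            by (simp add: mult_nonneg_nonpos)
        qed
      qed (use j fin ne c_pos in auto)
      also have "\<dots> \<le> max_lse N A c 0"
        unfolding max_lse_def using j by (intro Max_ge) auto
      finally show ?thesis .
    qed
    then show ?thesis
      unfolding max_lse_def[of _ _ _ "t *\<^sub>R x"] using N by (subst Max_le_iff) auto
  qed
  moreover have "bounded {y. max_lse N A c y \<le> max_lse N A c 0}"
    using assms unfolding coercive_def by (intro compact_imp_bounded) blast
  then obtain r where "\<And>y. max_lse N A c y \<le> max_lse N A c 0 \<Longrightarrow> norm y \<le> r"
    unfolding bounded_iff by blast
  \<comment> \<open>A point of the ray beyond the bound \<open>r\<close>: a vector of sup norm 1 has
    Euclidean norm at least 1.\<close>
  ultimately have "norm ((\<bar>r\<bar> + 1) *\<^sub>R x) \<le> r"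
    by (metis abs_ge_zero add_nonneg_nonneg zero_le_one)
  moreover have "norm x \<ge> 1"
    using infnorm_le_norm[of x] x(1) by simp
  then have "(\<bar>r\<bar> + 1) * 1 \<le> (\<bar>r\<bar> + 1) * norm x"
    by (intro mult_left_mono) auto
  ultimately show False
    by simp
qed

text \<open>Scaling \<open>x\<close> to the unit sphere yields an exponent \<open>a\<close> with
  \<open>a \<bullet> x\<close> at least the coercivity constant times \<open>infnorm x\<close>.
  Keeping only the term of \<open>a\<close> in a sum containing it gives the bound.\<close>

lemma max_lse_ge: "t_min N A c + coercivity_constant (\<Union>j\<in>{1..N}. A j) * infnorm x \<le> max_lse N A c x"
proof -
  let ?A = "\<Union>j\<in>{1..N}. A j"
  define \<nu> where "\<nu> = coercivity_constant ?A"
  have "\<exists>a\<in>?A. \<nu> * infnorm x \<le> a \<bullet> x"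
  proof (cases "x = 0")
    case True
    then show ?thesis
      using exponents_nonempty by (auto simp: infnorm_0)
  next
    case False
    define y where "y = (1 / infnorm x) *\<^sub>R x"
    have nx: "infnorm x > 0"
      using False by (simp add: infnorm_pos_lt)
    then have "infnorm y = 1"
      by (simp add: y_def infnorm_mul)
    then have "\<nu> \<le> Max ((\<lambda>a. a \<bullet> y) ` ?A)"
      unfolding \<nu>_def
      using coercivity_constant_attained[OF finite_exponents exponents_nonempty] by metis
    then obtain a where "a \<in> ?A" "\<nu> \<le> a \<bullet> y"
      using finite_exponents exponents_nonempty by (subst (asm) Max_ge_iff) auto
    moreover from this nx have "\<nu> * infnorm x \<le> a \<bullet> x"
      by (simp add: y_def pos_le_divide_eq)
    ultimately show ?thesis
      by blast
  qed
  then obtain j a where a: "j \<in> {1..N}" "a \<in> A j" "\<nu> * infnorm x \<le> a \<bullet> x"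
    by blast
  have "{ln (c j a) | j a. j \<in> {1..N} \<and> a \<in> A j} = (\<Union>j\<in>{1..N}. (\<lambda>a. ln (c j a)) ` A j)"
    by blast
  then have "finite {ln (c j a) | j a. j \<in> {1..N} \<and> a \<in> A j}"
    using fin by simp
  then have "t_min N A c \<le> ln (c j a)"
    unfolding t_min_def using a by (intro Min_le) auto
  then have "t_min N A c + \<nu> * infnorm x \<le> ln (c j a) + a \<bullet> x"
    using a(3) by simp
  also have "\<dots> \<le> lse (A j) (c j) x"
    using a fin c_pos by (intro lse_ge) auto
  also have "\<dots> \<le> max_lse N A c x"
    unfolding max_lse_def using a(1) by (intro Max_ge) auto
  finally show ?thesis
    by (simp add: \<nu>_def)
qed

end

section \<open>Norm bound for minimizers and ordering of the exponents\<close>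

theorem theorem1p2:
  fixes N :: nat
    and A :: "nat \<Rightarrow> (real ^ 'n) set"
    and c :: "nat \<Rightarrow> real ^ 'n \<Rightarrow> real"
  assumes "1 \<le> N"
    and "\<And>j. j \<in> {1..N} \<Longrightarrow> finite (A j)"
    and "\<And>j. j \<in> {1..N} \<Longrightarrow> A j \<noteq> {}"
    and "\<And>j a. j \<in> {1..N} \<Longrightarrow> a \<in> A j \<Longrightarrow> 0 < c j a"
    and "coercive (max_lse N A c)"
  shows "(\<forall>xstar. (\<forall>x. max_lse N A c xstar \<le> max_lse N A c x) \<longrightarrow>
            infnorm xstar \<le> (max_lse N A c 0 - t_min N A c) / coercivity_constant (\<Union>j\<in>{1..N}. A j))
       \<and> ((\<forall>j\<in>{1..N}. \<forall>a\<in>A j. \<forall>i. a $ i \<in> \<int>) \<longrightarrow>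
            (\<forall>M b. M = card (\<Union>j\<in>{1..N}. A j) \<and>
                bij_betw b {1..M} (\<Union>j\<in>{1..N}. A j) \<and>
                (\<forall>i\<in>{1..M}. \<forall>k\<in>{1..M}. i \<le> k \<longrightarrow> norm (b k) \<le> norm (b i)) \<longrightarrow>
              1 / (\<Prod>i = 1..CARD('n). sqrt ((norm (b i))\<^sup>2 + 1))
                \<le> coercivity_constant (\<Union>j\<in>{1..N}. A j)))"
proof (intro conjI allI impI)
  let ?A = "\<Union>j\<in>{1..N}. A j"
  have pos: "coercivity_constant ?A > 0"
    using assms by (rule coercivity_constant_pos)
  fix xstar assume "\<forall>x. max_lse N A c xstar \<le> max_lse N A c x"
  then have "max_lse N A c xstar \<le> max_lse N A c 0"
    by blast
  moreover have "t_min N A c + coercivity_constant ?A * infnorm xstar \<le> max_lse N A c xstar"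
    using assms(1-4) by (rule max_lse_ge)
  ultimately show "infnorm xstar \<le> (max_lse N A c 0 - t_min N A c) / coercivity_constant ?A"
    using pos by (simp add: pos_le_divide_eq mult.commute)
next
  let ?A = "\<Union>j\<in>{1..N}. A j"
  fix M b
  assume "\<forall>j\<in>{1..N}. \<forall>a\<in>A j. \<forall>i. a $ i \<in> \<int>"
  then have int: "a $ i \<in> \<int>" if "a \<in> ?A" for a i
    using that by blast
  assume *: "M = card ?A \<and> bij_betw b {1..M} ?A \<and>
    (\<forall>i\<in>{1..M}. \<forall>k\<in>{1..M}. i \<le> k \<longrightarrow> norm (b k) \<le> norm (b i))"
  then have bij: "bij_betw b {1..M} ?A"
    by (elim conjE)
  have decreasing: "norm (b k) \<le> norm (b i)" if "1 \<le> i" "i \<le> k" "k \<le> M" for i k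
    using * that by (meson atLeastAtMost_iff order_trans)
  define w where "w = (\<lambda>a :: real ^ 'n. sqrt ((norm a)\<^sup>2 + 1))"
  have w: "w a \<ge> 1" "w a > 0" for a
    by (simp_all add: w_def add_nonneg_pos)
  have "finite ?A"
    using assms(1-4) by (rule finite_exponents)
  moreover have "?A \<noteq> {}"
    using assms(1-4) by (rule exponents_nonempty)
  moreover note int
  moreover have "coercivity_constant ?A > 0"
    using assms by (rule coercivity_constant_pos)
  ultimately obtain S where S: "S \<subseteq> ?A" "card S \<le> CARD('n)"
    "1 / (\<Prod>a\<in>S. w a) \<le> coercivity_constant ?A"
    unfolding w_def by (rule coercivity_constant_lower_bound)
  \<comment> \<open>The indices of the exponents in \<open>S\<close>, so that the ordering by norm
    can be applied.\<close>
  define I where "I = {i \<in> {1..M}. b i \<in> S}"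
  have bI: "bij_betw b I S"
  proof (rule bij_betw_imageI)
    have "b ` {1..M} = ?A"
      using bij by (rule bij_betw_imp_surj_on)
    then have "S \<subseteq> b ` {1..M}"
      using S(1) by (simp only:)
    then show "b ` I = S"
      unfolding I_def by blast
    show "inj_on b I"
      using bij_betw_imp_inj_on[OF bij] by (rule inj_on_subset) (auto simp: I_def)
  qed
  have "(\<Prod>a\<in>S. w a) = (\<Prod>i\<in>I. w (b i))"
    using prod.reindex_bij_betw[OF bI, of w] by simp
  also have "\<dots> \<le> (\<Prod>i=1..card S. w (b i))"
  proof (rule prod_le_prod_initial_segment[where M = M])
    show "w (b k) \<le> w (b i)" if "1 \<le> i" "i \<le> k" "k \<le> M" for i k
      using decreasing[OF that] by (simp add: w_def power_mono)
    show "w (b i) \<ge> 0" for i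
      using w(2)[of "b i"] by simp
  qed (use bij_betw_same_card[OF bI] in \<open>auto simp: I_def\<close>)
  \<comment> \<open>\<open>S\<close> may have fewer than \<open>CARD('n)\<close> elements; as
    \<open>w\<close> is at least 1 at every vector, further factors only enlarge the
    product.\<close>
  also have "\<dots> \<le> (\<Prod>i=1..CARD('n). w (b i))"
    using S(2) w by (intro prod_mono2) (auto intro: less_imp_le)
  finally have "1 / (\<Prod>i=1..CARD('n). w (b i)) \<le> 1 / (\<Prod>a\<in>S. w a)"
    using w(2) by (intro divide_left_mono mult_pos_pos prod_pos) auto
  then show "1 / (\<Prod>i = 1..CARD('n). sqrt ((norm (b i))\<^sup>2 + 1)) \<le> coercivity_constant ?A"
    using S(3) unfolding w_def by linarith
qed

end
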